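(* (Associated Wall case.) Let $0<|q|<1$, let $A,B$ be nonzero complex numbers, and let $$a_n=\Big(\tfrac1A+\tfrac1B\Big)q^n-(1+q)q^{2n-1},\qquad b_n^2=\frac{q^{2n-1}}{AB}(1-Aq^{n-1})(1-Bq^{n-1}),$$ with $b_n^2\neq0$ for $n\ge1$. Then for $z\neq0$ for which the right-hand side is defined, $$\cfrac{1}{z-a_0-\cfrac{b_1^2}{z-a_1-\cfrac{b_2^2}{z-a_2-\cdots}}}=\frac{{}_1\phi_1\left(\begin{matrix}B\\ q/(Az)\end{matrix};\frac{q}{Bz}\right)}{z\left(1-\frac1{Az}\right){}_1\phi_1\left(\begin{matrix}B/q\\ 1/(Az)\end{matrix};\frac{1}{Bz}\right)}.$$
   Context: Notation: $(a)_k=\prod_{j=0}^{k-1}(1-aq^j)$ and ${}_1\phi_1\left(\begin{matrix}a\\ c\end{matrix};w\right)=\sum_{k\ge0}\frac{(a)_k}{(c)_k(q)_k}(-1)^kq^{k(k-1)/2}w^k$. "Defined" means that no lower parameter is of the form $q^{-k}$ ($k\ge0$) and the denominator does not vanish. *)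

theory Defs
  imports "HOL-Analysis.Analysis"
begin

section \<open>Basic hypergeometric series\<close>

definition qpoch :: "complex \<Rightarrow> complex \<Rightarrow> nat \<Rightarrow> complex" where
  "qpoch q a k = (\<Prod>j<k. 1 - a * q ^ j)"

definition phi11 :: "complex \<Rightarrow> complex \<Rightarrow> complex \<Rightarrow> complex \<Rightarrow> complex" where
  "phi11 q a c w =
     (\<Sum>k. qpoch q a k / (qpoch q c k * qpoch q q k) * (-1) ^ k * q ^ (k * (k - 1) div 2) * w ^ k)"

definition admissible_lower :: "complex \<Rightarrow> complex \<Rightarrow> bool" where
  "admissible_lower q c \<longleftrightarrow> (\<forall>k::nat. c \<noteq> q powi (- int k))"


section \<open>Continued fractions\<close>

text \<open>
  Approximants are evaluated in the extended complex plane, with \<^term>\<open>None\<close> standing for the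
  point at infinity, so that a vanishing intermediate denominator is treated correctly and is not
  subject to the convention \<open>x / 0 = 0\<close>. The function below is the map
  \<open>w \<mapsto> \<alpha> / (\<beta> + w)\<close> for \<open>\<alpha> \<noteq> 0\<close>, the only case in which it is meaningful.
\<close>

fun cfrac_step :: "complex \<Rightarrow> complex \<Rightarrow> complex option \<Rightarrow> complex option" where
  "cfrac_step \<alpha> \<beta> None = Some 0"
| "cfrac_step \<alpha> \<beta> (Some w) = (if \<beta> + w = 0 then None else Some (\<alpha> / (\<beta> + w)))"

text \<open>
  The \<open>n\<close>-th approximant of \<open>\<alpha> 0 / (\<beta> 0 + \<alpha> 1 / (\<beta> 1 + \<dots>))\<close>, that is
  \<open>\<alpha> 0 / (\<beta> 0 + \<dots> + \<alpha> (n-1) / \<beta> (n-1))\<close>.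
\<close>

fun cfrac_approx :: "(nat \<Rightarrow> complex) \<Rightarrow> (nat \<Rightarrow> complex) \<Rightarrow> nat \<Rightarrow> complex option" where
  "cfrac_approx \<alpha> \<beta> 0 = Some 0"
| "cfrac_approx \<alpha> \<beta> (Suc n) =
     cfrac_step (\<alpha> 0) (\<beta> 0) (cfrac_approx (\<lambda>i. \<alpha> (Suc i)) (\<lambda>i. \<beta> (Suc i)) n)"

text \<open>Convergence to a finite value; finitely many approximants may be infinite.\<close>

definition cfrac_has_value :: "(nat \<Rightarrow> complex) \<Rightarrow> (nat \<Rightarrow> complex) \<Rightarrow> complex \<Rightarrow> bool" where
  "cfrac_has_value \<alpha> \<beta> L \<longleftrightarrow>
     (\<forall>\<^sub>F n in sequentially. cfrac_approx \<alpha> \<beta> n \<noteq> None) \<and>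
     (\<lambda>n. the (cfrac_approx \<alpha> \<beta> n)) \<longlonglongrightarrow> L"

text \<open>
  The J-fraction \<open>1 / (z - a 0 - b2 1 / (z - a 1 - b2 2 / (z - a 2 - \<dots>)))\<close>;
  the value \<open>b2 0\<close> is not used.
\<close>

definition jfrac_has_value ::
    "(nat \<Rightarrow> complex) \<Rightarrow> (nat \<Rightarrow> complex) \<Rightarrow> complex \<Rightarrow> complex \<Rightarrow> bool" where
  "jfrac_has_value a b2 z L \<longleftrightarrow>
     cfrac_has_value (\<lambda>n. if n = 0 then 1 else - b2 n) (\<lambda>n. z - a n) L"


section \<open>Coefficients of the associated Wall case\<close>

text \<open>Integer powers are used because \<open>q\<close> occurs with exponent \<open>2n - 1 = -1\<close> at \<open>n = 0\<close>.\<close>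

definition wall_a :: "complex \<Rightarrow> complex \<Rightarrow> complex \<Rightarrow> nat \<Rightarrow> complex" where
  "wall_a q A B n = (1 / A + 1 / B) * q ^ n - (1 + q) * q powi (2 * int n - 1)"

definition wall_b2 :: "complex \<Rightarrow> complex \<Rightarrow> complex \<Rightarrow> nat \<Rightarrow> complex" where
  "wall_b2 q A B n =
     q powi (2 * int n - 1) / (A * B)
       * (1 - A * q powi (int n - 1)) * (1 - B * q powi (int n - 1))"

end

(*
  Put a = B/q, c = 1/(Az), w = 1/(Bz). The series X n = phi11 (a q^n) (c q^n) (w q^n) satisfies a
  three-term contiguous relation; divided by the product of z (1 - c q^j), j < n, it becomes a
  solution k of the backward recurrence k n = \<beta> n * k (n+1) + \<alpha> (n+1) * k (n+2)
  attached to the J-fraction. If D n is the denominator of the n-th approximant, then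
      k 0 = k (n+1) * D (n+1) + \<alpha> (n+1) * k (n+2) * D n.
  Since X n tends to 1, the ratio \<alpha> (n+1) * k (n+2) / k n tends to 0, and this forces
  k n * D n to tend to k 0. The numerators are the denominators of the fraction shifted by one, so
  the quotient of the two limits is k 1 / k 0.
*)
theory Submission
  imports Defs
begin

section \<open>Continued fractions and recurrences\<close>

text \<open>Denominators of the approximants, expanded at the front rather than by the usual
  recurrence at the last index, to match the recursion of \<open>cfrac_approx\<close>.\<close>

fun continuant :: "(nat \<Rightarrow> complex) \<Rightarrow> (nat \<Rightarrow> complex) \<Rightarrow> nat \<Rightarrow> complex" where
  "continuant \<alpha> \<beta> 0 = 1"
| "continuant \<alpha> \<beta> (Suc 0) = \<beta> 0"
| "continuant \<alpha> \<beta> (Suc (Suc n)) =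
     \<beta> 0 * continuant (\<lambda>i. \<alpha> (Suc i)) (\<lambda>i. \<beta> (Suc i)) (Suc n)
     + \<alpha> 1 * continuant (\<lambda>i. \<alpha> (Suc (Suc i))) (\<lambda>i. \<beta> (Suc (Suc i))) n"

text \<open>A common zero would, as \<open>\<alpha> 1\<close> is nonzero, pass on to the shifted
  pair and finally reach the empty continuant, which is 1. Hence an approximant is never of the form
  0/0.\<close>

lemma continuant_nonzero:
  assumes "\<And>n. \<alpha> n \<noteq> 0" and "continuant \<alpha> \<beta> (Suc n) = 0"
  shows "continuant (\<lambda>i. \<alpha> (Suc i)) (\<lambda>i. \<beta> (Suc i)) n \<noteq> 0"
  using assms
proof (induction n arbitrary: \<alpha> \<beta>)
  case (Suc n)
  have nz: "\<And>n. \<alpha> (Suc n) \<noteq> 0"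
    using Suc.prems by simp
  show ?case
    using Suc.IH[of "\<lambda>i. \<alpha> (Suc i)" "\<lambda>i. \<beta> (Suc i)", OF nz] Suc.prems by auto
qed simp

lemma cfrac_approx_continuant:
  assumes "\<And>n. \<alpha> n \<noteq> 0"
  shows "cfrac_approx \<alpha> \<beta> (Suc n) =
    (if continuant \<alpha> \<beta> (Suc n) = 0 then None
     else Some (\<alpha> 0 * continuant (\<lambda>i. \<alpha> (Suc i)) (\<lambda>i. \<beta> (Suc i)) n / continuant \<alpha> \<beta> (Suc n)))"
  using assms
proof (induction n arbitrary: \<alpha> \<beta>)
  case (Suc n)
  define C where "C = continuant (\<lambda>i. \<alpha> (Suc i)) (\<lambda>i. \<beta> (Suc i)) (Suc n)"
  define D where "D = continuant (\<lambda>i. \<alpha> (Suc (Suc i))) (\<lambda>i. \<beta> (Suc (Suc i))) n"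
  have nz: "\<And>n. \<alpha> (Suc n) \<noteq> 0"
    using Suc.prems by simp
  have D: "D \<noteq> 0" if "C = 0"
    using continuant_nonzero[of "\<lambda>i. \<alpha> (Suc i)" "\<lambda>i. \<beta> (Suc i)" n] nz that
    by (simp add: C_def D_def)
  have rec: "continuant \<alpha> \<beta> (Suc (Suc n)) = \<beta> 0 * C + \<alpha> 1 * D"
    by (simp add: C_def D_def)
  have approx: "cfrac_approx \<alpha> \<beta> (Suc (Suc n)) =
      cfrac_step (\<alpha> 0) (\<beta> 0) (if C = 0 then None else Some (\<alpha> 1 * D / C))"
    using Suc.IH[of "\<lambda>i. \<alpha> (Suc i)" "\<lambda>i. \<beta> (Suc i)", OF nz] by (simp add: C_def D_def)
  show ?case
  \<comment> \<open>If \<open>C = 0\<close>, the inner approximant is infinite and the outer one is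
    0. The quotient agrees, since its numerator is \<open>\<alpha> 0 * C\<close> and its denominator
    \<open>\<alpha> 1 * D\<close> is nonzero.\<close>
  proof (cases "C = 0")
    case True
    then show ?thesis
      using D nz[of 0] unfolding approx rec C_def[symmetric] by simp
  next
    case False
    then have "\<beta> 0 + \<alpha> 1 * D / C = (\<beta> 0 * C + \<alpha> 1 * D) / C"
      by (simp add: field_simps)
    then show ?thesis
      using False unfolding approx rec C_def[symmetric] by simp
  qed
qed simp

text \<open>The recurrence unrolled from \<open>k 0\<close>: the identities for the sequences
  shifted by one and by two are inserted into its first instance, and the front expansion of the
  continuants recombines the coefficients.\<close>

lemma recurrence_continuant:
  assumes "\<And>n. k n = \<beta> n * k (Suc n) + \<alpha> (Suc n) * k (Suc (Suc n))"
  shows "k 0 = k (Suc n) * continuant \<alpha> \<beta> (Suc n) + \<alpha> (Suc n) * k (Suc (Suc n)) * continuant \<alpha> \<beta> n"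
  using assms
proof (induction n arbitrary: k \<alpha> \<beta> rule: induct_nat_012)
  case 0
  show ?case
    using 0[of 0] by (simp add: algebra_simps)
next
  case 1
  have "k 0 = \<beta> 0 * (\<beta> 1 * k 2 + \<alpha> 2 * k 3) + \<alpha> 1 * k 2"
    using 1[of 0] 1[of 1] by (simp add: numeral_2_eq_2 numeral_3_eq_3)
  then show ?case
    using 1[of 1] by (simp add: algebra_simps numeral_2_eq_2 numeral_3_eq_3)
next
  case (ge2 n)
  note IH1 = ge2.IH(2)[of "\<lambda>i. k (Suc i)" "\<lambda>i. \<beta> (Suc i)" "\<lambda>i. \<alpha> (Suc i)", OF ge2.prems]
  note IH2 = ge2.IH(1)[of "\<lambda>i. k (Suc (Suc i))" "\<lambda>i. \<beta> (Suc (Suc i))" "\<lambda>i. \<alpha> (Suc (Suc i))",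
      OF ge2.prems]
  have "k 0 = \<beta> 0 * k (Suc 0) + \<alpha> (Suc 0) * k (Suc (Suc 0))"
    by (rule ge2.prems)
  then show ?case
    unfolding IH1 IH2 by (simp add: algebra_simps)
qed

section \<open>Limits of perturbed recurrences and convergence of the approximants\<close>

lemma tendsto_zero_eventually_norm_less:
  fixes f :: "'a \<Rightarrow> 'b::real_normed_vector"
  assumes "(f \<longlongrightarrow> 0) F" and "e > 0"
  shows "\<forall>\<^sub>F x in F. norm (f x) < e"
  using assms by (intro order_tendstoD(2)[OF tendsto_norm_zero])

text \<open>Once the norm of \<open>\<epsilon> n\<close> is below 1/2 the recursion keeps
  \<open>v\<close> bounded; then \<open>\<epsilon> n * v n\<close> tends to 0 and only
  \<open>c\<close> survives.\<close>

lemma tendsto_perturbed_constant: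
  fixes v :: "nat \<Rightarrow> 'a::real_normed_algebra"
  assumes rec: "\<forall>\<^sub>F n in sequentially. v (Suc n) = c + \<epsilon> n * v n"
    and lim: "\<epsilon> \<longlonglongrightarrow> 0"
  shows "v \<longlonglongrightarrow> c"
proof -
  have "\<forall>\<^sub>F n in sequentially. norm (\<epsilon> n) < 1/2"
    using lim by (rule tendsto_zero_eventually_norm_less) simp
  then have "\<forall>\<^sub>F n in sequentially. v (Suc n) = c + \<epsilon> n * v n \<and> norm (\<epsilon> n) < 1/2"
    using rec eventually_conj by blast
  then obtain N where N: "\<And>n. n \<ge> N \<Longrightarrow> v (Suc n) = c + \<epsilon> n * v n"
    "\<And>n. n \<ge> N \<Longrightarrow> norm (\<epsilon> n) < 1/2"
    unfolding eventually_sequentially by blast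
  \<comment> \<open>Chosen to dominate the starting value and to satisfy
    \<open>norm c + M / 2 \<le> M\<close>, so that the bound reproduces itself.\<close>
  define M where "M = max (norm (v N)) (2 * norm c)"
  have bound: "norm (v n) \<le> M" if "n \<ge> N" for n
    using that
  proof (induction n rule: dec_induct)
    case (step n)
    have "norm (v (Suc n)) \<le> norm c + norm (\<epsilon> n * v n)"
      using N(1)[of n] step norm_triangle_ineq by simp
    also have "norm (\<epsilon> n * v n) \<le> norm (\<epsilon> n) * norm (v n)"
      by (rule norm_mult_ineq)
    also have "\<dots> \<le> 1/2 * M"
      using N(2)[of n] step by (intro mult_mono) auto
    finally show ?case
      unfolding M_def by linarith
  qed (simp add: M_def)
  have "(\<lambda>n. \<epsilon> n * v n) \<longlonglongrightarrow> 0"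
  proof (rule Lim_null_comparison)
    show "\<forall>\<^sub>F n in sequentially. norm (\<epsilon> n * v n) \<le> norm (\<epsilon> n) * M"
      unfolding eventually_sequentially
      by (meson N bound mult_left_mono norm_ge_zero norm_mult_ineq order_trans)
    show "(\<lambda>n. norm (\<epsilon> n) * M) \<longlonglongrightarrow> 0"
      using tendsto_mult_left_zero[OF tendsto_norm_zero[OF lim]] .
  qed
  then have "(\<lambda>n. c + \<epsilon> n * v n) \<longlonglongrightarrow> c"
    using tendsto_add[OF tendsto_const, of _ 0 _ c] by simp
  then have "(\<lambda>n. v (Suc n)) \<longlonglongrightarrow> c"
    by (rule Lim_transform_eventually) (use rec in eventually_elim, simp)
  then show ?thesis
    by (rule filterlim_sequentially_Suc[THEN iffD1])
qed

text \<open>For \<open>v n = k n * continuant \<alpha> \<beta> n\<close> the unrolled identity is a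
  perturbed constant recursion with limit \<open>k 0\<close>. Dividing by \<open>k n\<close> to
  exhibit the perturbation requires it to be nonzero eventually.\<close>

lemma recurrence_continuant_tendsto:
  assumes rec: "\<And>n. k n = \<beta> n * k (Suc n) + \<alpha> (Suc n) * k (Suc (Suc n))"
    and nz: "\<forall>\<^sub>F n in sequentially. k n \<noteq> 0"
    and lim: "(\<lambda>n. \<alpha> (Suc n) * k (Suc (Suc n)) / k n) \<longlonglongrightarrow> 0"
  shows "(\<lambda>n. k n * continuant \<alpha> \<beta> n) \<longlonglongrightarrow> k 0"
proof (rule tendsto_perturbed_constant)
  show "\<forall>\<^sub>F n in sequentially. k (Suc n) * continuant \<alpha> \<beta> (Suc n) =
      k 0 + - (\<alpha> (Suc n) * k (Suc (Suc n)) / k n) * (k n * continuant \<alpha> \<beta> n)"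
    using nz
  proof eventually_elim
    case (elim n)
    then show ?case
      using recurrence_continuant[of k \<beta> \<alpha> n, OF rec] by (simp add: field_simps)
  qed
  show "(\<lambda>n. - (\<alpha> (Suc n) * k (Suc (Suc n)) / k n)) \<longlonglongrightarrow> 0"
    using tendsto_minus[OF lim] by simp
qed

text \<open>A criterion in the manner of Pincherle's theorem: multiplied by the same factor
  \<open>k (Suc n)\<close>, numerators and denominators tend to \<open>k 1\<close> and
  \<open>k 0\<close>, and the factor cancels in the quotient.\<close>

theorem cfrac_has_value_of_recurrence:
  assumes rec: "\<And>n. k n = \<beta> n * k (Suc n) + \<alpha> (Suc n) * k (Suc (Suc n))"
    and \<alpha>: "\<And>n. \<alpha> n \<noteq> 0"
    and k0: "k 0 \<noteq> 0"
    and nz: "\<forall>\<^sub>F n in sequentially. k n \<noteq> 0"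
    and lim: "(\<lambda>n. \<alpha> (Suc n) * k (Suc (Suc n)) / k n) \<longlonglongrightarrow> 0"
  shows "cfrac_has_value \<alpha> \<beta> (\<alpha> 0 * k 1 / k 0)"
proof -
  define Q where "Q n = continuant \<alpha> \<beta> (Suc n)" for n
  define P where "P n = continuant (\<lambda>i. \<alpha> (Suc i)) (\<lambda>i. \<beta> (Suc i)) n" for n
  have Q: "(\<lambda>n. k (Suc n) * Q n) \<longlonglongrightarrow> k 0"
    using recurrence_continuant_tendsto[of k \<beta> \<alpha>, OF rec nz lim]
    unfolding Q_def by (rule filterlim_sequentially_Suc[THEN iffD2])
  have P: "(\<lambda>n. k (Suc n) * P n) \<longlonglongrightarrow> k 1"
    using recurrence_continuant_tendsto[of "\<lambda>n. k (Suc n)" "\<lambda>n. \<beta> (Suc n)" "\<lambda>n. \<alpha> (Suc n)", OF rec]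
      nz[THEN eventually_sequentially_Suc[THEN iffD2]] lim[THEN LIMSEQ_Suc]
    by (simp add: P_def)
  \<comment> \<open>The nonzero limit makes the approximants finite from some index on and also
    allows \<open>k (Suc n)\<close> to be cancelled.\<close>
  have Qnz: "\<forall>\<^sub>F n in sequentially. k (Suc n) * Q n \<noteq> 0"
    using tendsto_imp_eventually_ne[OF Q k0] .
  have approx: "cfrac_approx \<alpha> \<beta> (Suc n) = (if Q n = 0 then None else Some (\<alpha> 0 * P n / Q n))" for n
    using cfrac_approx_continuant[of \<alpha> \<beta> n, OF \<alpha>] by (simp add: P_def Q_def)
  have "(\<lambda>n. \<alpha> 0 * (k (Suc n) * P n) / (k (Suc n) * Q n)) \<longlonglongrightarrow> \<alpha> 0 * k 1 / k 0"
    by (intro tendsto_intros P Q k0)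
  then have "(\<lambda>n. the (cfrac_approx \<alpha> \<beta> (Suc n))) \<longlonglongrightarrow> \<alpha> 0 * k 1 / k 0"
    by (rule Lim_transform_eventually) (use Qnz in eventually_elim, simp add: approx del: cfrac_approx.simps)
  moreover have "\<forall>\<^sub>F n in sequentially. cfrac_approx \<alpha> \<beta> (Suc n) \<noteq> None"
    using Qnz by eventually_elim (simp add: approx del: cfrac_approx.simps)
  ultimately show ?thesis
    unfolding cfrac_has_value_def
    using filterlim_sequentially_Suc eventually_sequentially_Suc by blast
qed


section \<open>The basic hypergeometric series\<close>

definition phi11_term :: "complex \<Rightarrow> complex \<Rightarrow> complex \<Rightarrow> complex \<Rightarrow> nat \<Rightarrow> complex" where
  "phi11_term q a c w k =
     qpoch q a k / (qpoch q c k * qpoch q q k) * (-1) ^ k * q ^ (k * (k - 1) div 2) * w ^ k"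

lemma qpoch_0 [simp]: "qpoch q a 0 = 1"
  by (simp add: qpoch_def)

lemma qpoch_Suc: "qpoch q a (Suc k) = qpoch q a k * (1 - a * q ^ k)"
  by (simp add: qpoch_def)

lemma qpoch_Suc_left: "qpoch q a (Suc k) = (1 - a) * qpoch q (a * q) k"
  by (simp add: qpoch_def prod.lessThan_Suc_shift mult.assoc del: prod.lessThan_Suc)

lemma qpoch_nonzero: "(\<And>j. c * q ^ j \<noteq> 1) \<Longrightarrow> qpoch q c k \<noteq> 0"
  by (auto simp: qpoch_def)

lemma qpoch_base_nonzero:
  assumes "norm q < 1"
  shows "qpoch q q k \<noteq> 0"
proof (rule qpoch_nonzero)
  fix j
  have "norm q * norm q ^ j \<le> norm q * 1"
    using assms by (intro mult_left_mono power_le_one) auto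
  then have "norm (q * q ^ j) < 1"
    using assms by (simp add: norm_mult norm_power)
  then show "q * q ^ j \<noteq> 1"
    by auto
qed

section \<open>Term ratios, convergence, and the limit for vanishing parameters\<close>

lemma triangle_Suc: "Suc k * (Suc k - 1) div 2 = k * (k - 1) div 2 + k"
  by (cases k) (auto simp: algebra_simps)

lemma phi11_term_Suc:
  "phi11_term q a c w (Suc k) =
     - ((1 - a * q ^ k) * q ^ k * w / ((1 - c * q ^ k) * (1 - q * q ^ k))) * phi11_term q a c w k"
  unfolding phi11_term_def qpoch_Suc triangle_Suc power_add by (simp add: mult_ac)

text \<open>The quadratic exponent contributes a factor \<open>q ^ k\<close> to the term ratio,
  which therefore tends to 0 for every \<open>w\<close>.\<close>

lemma summable_phi11_term:
  assumes "norm q < 1"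
  shows "summable (phi11_term q a c w)"
proof -
  have q: "(\<lambda>k. q ^ k) \<longlonglongrightarrow> 0"
    using assms by (rule LIMSEQ_power_zero)
  have "(\<lambda>k. - ((1 - a * q ^ k) * q ^ k * w / ((1 - c * q ^ k) * (1 - q * q ^ k)))) \<longlonglongrightarrow>
      - ((1 - a * 0) * 0 * w / ((1 - c * 0) * (1 - q * 0)))"
    by (intro tendsto_intros q) auto
  then have "(\<lambda>k. - ((1 - a * q ^ k) * q ^ k * w / ((1 - c * q ^ k) * (1 - q * q ^ k)))) \<longlonglongrightarrow> 0"
    by simp
  then have "\<forall>\<^sub>F k in sequentially.
      norm (- ((1 - a * q ^ k) * q ^ k * w / ((1 - c * q ^ k) * (1 - q * q ^ k)))) < 1/2"
    by (rule tendsto_zero_eventually_norm_less) simp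
  then obtain N where N: "\<And>k. k \<ge> N \<Longrightarrow>
      norm (- ((1 - a * q ^ k) * q ^ k * w / ((1 - c * q ^ k) * (1 - q * q ^ k)))) < 1/2"
    unfolding eventually_sequentially by blast
  show ?thesis
  proof (rule summable_ratio_test[of "1/2" N])
    fix k assume "k \<ge> N"
    then show "norm (phi11_term q a c w (Suc k)) \<le> 1/2 * norm (phi11_term q a c w k)"
      unfolding phi11_term_Suc norm_mult[of _ "phi11_term q a c w k"]
      by (intro mult_right_mono less_imp_le[OF N]) auto
  qed simp
qed

lemma phi11_term_sums: "norm q < 1 \<Longrightarrow> phi11_term q a c w sums phi11 q a c w"
  using summable_sums[OF summable_phi11_term, of q a c w]
  by (simp add: phi11_def phi11_term_def[abs_def])

text \<open>Comparison with a geometric series of ratio \<open>M \<le> 1/2\<close>: the terms after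
  the constant term 1 add up to at most \<open>M / (1 - M) \<le> 2 * M\<close>. The bound is uniform
  in \<open>a\<close> and \<open>c\<close>.\<close>

lemma norm_phi11_minus_one_le:
  assumes q: "norm q < 1" and a: "norm a \<le> 1" and c: "norm c \<le> 1/2"
    and w: "8 * norm w \<le> 1 - norm q"
  shows "norm (phi11 q a c w - 1) \<le> 8 * norm w / (1 - norm q)"
proof -
  \<comment> \<open>Bound for the term ratio: the numerator factor is at most 2, the factor with
    \<open>c\<close> at least 1/2, the factor with \<open>q\<close> at least
    \<open>1 - norm q\<close>.\<close>
  define M where "M = 4 * norm w / (1 - norm q)"
  have M: "0 \<le> M" "M \<le> 1/2"
    using q w by (auto simp: M_def field_simps)
  have pow: "norm (q ^ k) \<le> 1" for k
    using q by (simp add: norm_power power_le_one)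
  have small: "norm (x * q ^ k) \<le> norm x" for x k
    using mult_left_mono[OF pow[of k] norm_ge_zero[of x]] by (simp add: norm_mult)
  have "norm (phi11_term q a c w (Suc k)) \<le> M * norm (phi11_term q a c w k)" for k
  proof -
    have "norm (1 - a * q ^ k) \<le> 2"
      using norm_triangle_ineq4[of 1 "a * q ^ k"] small[of a k] a by simp
    moreover have "1/2 \<le> norm (1 - c * q ^ k)"
      using norm_triangle_ineq2[of 1 "c * q ^ k"] small[of c k] c by simp
    moreover have "1 - norm q \<le> norm (1 - q * q ^ k)"
      using norm_triangle_ineq2[of 1 "q * q ^ k"] small[of q k] by simp
    ultimately have "norm (1 - a * q ^ k) * norm (q ^ k) * norm w /
        (norm (1 - c * q ^ k) * norm (1 - q * q ^ k)) \<le> 2 * 1 * norm w / (1/2 * (1 - norm q))"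
      using q pow[of k] by (intro frac_le mult_mono) auto
    also have "\<dots> = M"
      by (simp add: M_def)
    finally show ?thesis
      unfolding phi11_term_Suc norm_mult norm_minus_cancel norm_divide
      by (rule mult_right_mono) simp
  qed
  then have bound: "norm (phi11_term q a c w k) \<le> M ^ k" for k
  proof (induction k)
    case (Suc k)
    have "norm (phi11_term q a c w (Suc k)) \<le> M * norm (phi11_term q a c w k)"
      by (rule Suc)
    also have "\<dots> \<le> M * M ^ k"
      using Suc M by (intro mult_left_mono) auto
    finally show ?case by simp
  qed (simp add: phi11_term_def)
  have geo: "(\<lambda>k. M ^ Suc k) sums (M * (1 / (1 - M)))"
    unfolding power_Suc using M by (intro sums_mult geometric_sums) auto
  have "(\<lambda>k. phi11_term q a c w (Suc k)) sums (phi11 q a c w - 1)"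
    using phi11_term_sums[OF q, of a c w] by (subst sums_Suc_iff) (simp add: phi11_term_def)
  then have "norm (phi11 q a c w - 1) \<le> M * (1 / (1 - M))"
    by (rule norm_sums_le[OF _ geo]) (rule bound)
  also have "\<dots> \<le> M * 2"
    using M by (intro mult_left_mono) (auto simp: field_simps)
  finally show ?thesis
    by (simp add: M_def)
qed

text \<open>All three parameters move with \<open>n\<close>; the uniform bound is eventually
  applicable and reduces the claim to \<open>w\<close> tending to 0.\<close>

lemma phi11_tendsto_one:
  assumes q: "norm q < 1" and a: "a \<longlonglongrightarrow> 0" and c: "c \<longlonglongrightarrow> 0" and w: "w \<longlonglongrightarrow> 0"
  shows "(\<lambda>n. phi11 q (a n) (c n) (w n)) \<longlonglongrightarrow> 1"
proof -
  have "(\<lambda>n. phi11 q (a n) (c n) (w n) - 1) \<longlonglongrightarrow> 0"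
  proof (rule Lim_null_comparison)
    note ev = tendsto_zero_eventually_norm_less
    have "(1 - norm q) / 8 > 0"
      using q by simp
    from ev[OF a zero_less_one] ev[OF c half_gt_zero[OF zero_less_one]] ev[OF w this]
    show "\<forall>\<^sub>F n in sequentially.
        norm (phi11 q (a n) (c n) (w n) - 1) \<le> 8 * norm (w n) / (1 - norm q)"
    proof eventually_elim
      case (elim n)
      then show ?case
        by (intro norm_phi11_minus_one_le q) auto
    qed
    show "(\<lambda>n. 8 * norm (w n) / (1 - norm q)) \<longlonglongrightarrow> 0"
      using tendsto_divide[OF tendsto_mult[OF tendsto_const tendsto_norm_zero[OF w]] tendsto_const,
          of "1 - norm q" 8] q by simp
  qed
  then show ?thesis
    by (rule LIM_zero_cancel)
qed

section \<open>The three-term contiguous relation\<close>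

lemma phi11_term_Suc_left:
  "phi11_term q a c w (Suc k) =
     - ((1 - a) * w / ((1 - c) * (1 - q * q ^ k))) * phi11_term q (a * q) (c * q) (w * q) k"
  \<comment> \<open>The products in \<open>a\<close> and \<open>c\<close> lose their first factor,
    the one in \<open>q\<close> its last. The extra \<open>q ^ k\<close> of the triangular exponent
    turns \<open>w ^ k\<close> into \<open>(w * q) ^ k\<close>, so \<open>a\<close>,
    \<open>c\<close> and \<open>w\<close> all move by the factor \<open>q\<close>.\<close>
  unfolding phi11_term_def qpoch_Suc_left[of q a] qpoch_Suc_left[of q c] qpoch_Suc[of q q]
    triangle_Suc power_add power_mult_distrib
  by (simp add: mult_ac)

lemma sums_shift:
  fixes f :: "nat \<Rightarrow> 'a::real_normed_vector"
  assumes "f sums s"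
  shows "(\<lambda>k. case k of 0 \<Rightarrow> 0 | Suc j \<Rightarrow> f j) sums s"
  using assms sums_Suc_iff[of "\<lambda>k. case k of 0 \<Rightarrow> 0 | Suc j \<Rightarrow> f j" s] by simp

text \<open>Comparison of the coefficients of powers of \<open>w\<close>: a series multiplied by
  \<open>w\<close> or its square is delayed by one or two indices, so that index \<open>k\<close>
  collects exactly the power \<open>w ^ k\<close>.\<close>

lemma phi11_contiguous:
  assumes q: "norm q < 1" and c: "\<And>j. c * q ^ j \<noteq> 1"
  shows "(1 - c) * phi11 q a c w =
    (1 - c - w + (1 + q) * a * w) * phi11 q (a * q) (c * q) (w * q)
    - q * (c - a * q * w) * w * (1 - a * q) / (1 - c * q)
      * phi11 q (a * q * q) (c * q * q) (w * q * q)"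
proof -
  define T where "T = phi11_term q a c w"
  define T1 where "T1 = phi11_term q (a * q) (c * q) (w * q)"
  define T2 where "T2 = phi11_term q (a * q * q) (c * q * q) (w * q * q)"
  define shift :: "(nat \<Rightarrow> complex) \<Rightarrow> nat \<Rightarrow> complex"
    where "shift f k = (case k of 0 \<Rightarrow> 0 | Suc j \<Rightarrow> f j)" for f k
  \<comment> \<open>\<open>u\<close> and \<open>v\<close> split the coefficient of the last series
    into its parts linear and quadratic in \<open>w\<close>.\<close>
  define u where "u = q * c * w * (1 - a * q) / (1 - c * q)"
  define v where "v = a * q\<^sup>2 * w\<^sup>2 * (1 - a * q) / (1 - c * q)"
  have c0: "1 - c \<noteq> 0" "1 - c * q \<noteq> 0"
    using c[of 0] c[of 1] by auto
  have qne: "1 - q * q ^ j \<noteq> 0" for j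
    using qpoch_base_nonzero[OF q, of "Suc j"] by (simp add: qpoch_Suc)
  have shift: "shift f sums s" if "f sums s" for f s
    using sums_shift[OF that] by (simp add: shift_def[abs_def])
  have S: "T sums phi11 q a c w" "T1 sums phi11 q (a * q) (c * q) (w * q)"
    "T2 sums phi11 q (a * q * q) (c * q * q) (w * q * q)"
    unfolding T_def T1_def T2_def by (intro phi11_term_sums q)+
  have coeff: "(1 - c) * T k =
      (1 - c) * T1 k + (((1 + q) * a - 1) * w) * shift T1 k - u * shift T2 k + v * shift (shift T2) k"
    for k
  proof -
    \<comment> \<open>The indices 0 and 1 are separate because there some shifted terms take the
      default value 0.\<close>
    consider "k = 0" | "k = 1" | j where "k = Suc (Suc j)"
      by (metis One_nat_def not0_implies_Suc)
    then show ?thesis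
    proof cases
      case 1
      then show ?thesis
        by (simp add: shift_def T_def T1_def phi11_term_def)
    next
      case 2
      have "phi11_term q a' c' w' 0 = 1" for a' c' w'
        by (simp add: phi11_term_def)
      then show ?thesis
        using 2 c0 qne[of 0]
        by (simp add: shift_def T_def T1_def T2_def phi11_term_Suc u_def divide_simps)
           (simp add: algebra_simps)
    next
      case 3
      \<comment> \<open>All five terms involved are rational multiples of \<open>e\<close>, with
        coefficients depending on \<open>j\<close> only through \<open>y\<close>; what remains is a
        rational identity.\<close>
      define y where "y = q ^ j"
      define e where "e = T2 j"
      have ne: "1 - q * y \<noteq> 0" "1 - q * (q * y) \<noteq> 0" "1 - c * q * (q * y) \<noteq> 0"
        using qne[of j] qne[of "Suc j"] c[of "Suc (Suc j)"] by (auto simp: y_def mult.assoc)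
      have e1: "T1 (Suc j) = - ((1 - a * q) * (w * q) / ((1 - c * q) * (1 - q * y))) * e"
        unfolding T1_def phi11_term_Suc_left by (simp add: y_def e_def T2_def)
      have e2: "T (Suc (Suc j)) = - ((1 - a) * w / ((1 - c) * (1 - q * (q * y)))) * T1 (Suc j)"
        unfolding T_def T1_def phi11_term_Suc_left[of q a c w "Suc j"] by (simp add: y_def)
      have e3: "T1 (Suc (Suc j)) = - ((1 - a * q * (q * y)) * (q * y) * (w * q) /
          ((1 - c * q * (q * y)) * (1 - q * (q * y)))) * T1 (Suc j)"
        unfolding T1_def phi11_term_Suc[of _ _ _ _ "Suc j"] by (simp add: y_def)
      have e4: "T2 (Suc j) = - ((1 - a * q * (q * y)) * y * (w * q * q) /
          ((1 - c * q * (q * y)) * (1 - q * y))) * e"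
        unfolding T2_def phi11_term_Suc e_def by (simp add: y_def mult.assoc)
      show ?thesis
        unfolding 3 shift_def nat.case e2 e3 e1 e4 e_def[symmetric] u_def v_def
        using c0 ne by (simp add: divide_simps) algebra
    qed
  qed
  have "(\<lambda>k. (1 - c) * T k) sums ((1 - c) * phi11 q a c w)"
    by (intro sums_mult S)
  moreover have "(\<lambda>k. (1 - c) * T k) sums
      ((1 - c) * phi11 q (a * q) (c * q) (w * q)
       + (((1 + q) * a - 1) * w) * phi11 q (a * q) (c * q) (w * q)
       - u * phi11 q (a * q * q) (c * q * q) (w * q * q)
       + v * phi11 q (a * q * q) (c * q * q) (w * q * q))"
    unfolding coeff by (intro sums_add sums_diff sums_mult shift S)
  ultimately have "(1 - c) * phi11 q a c w =
      (1 - c) * phi11 q (a * q) (c * q) (w * q)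
       + (((1 + q) * a - 1) * w) * phi11 q (a * q) (c * q) (w * q)
       - u * phi11 q (a * q * q) (c * q * q) (w * q * q)
       + v * phi11 q (a * q * q) (c * q * q) (w * q * q)"
    by (rule sums_unique2)
  moreover have uv: "q * (c - a * q * w) * w * (1 - a * q) / (1 - c * q) = u - v"
    unfolding u_def v_def diff_divide_distrib[symmetric]
    by (rule arg_cong[of _ _ "\<lambda>x. x / _"]) algebra
  ultimately show ?thesis
    unfolding uv by (simp add: algebra_simps)
qed

section \<open>Application to the associated Wall coefficients\<close>

theorem mainTheorem8:
  fixes q A B z :: complex
  assumes "0 < norm q" and "norm q < 1"
    and "A \<noteq> 0" and "B \<noteq> 0"
    and "\<And>n. n \<ge> 1 \<Longrightarrow> wall_b2 q A B n \<noteq> 0"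
    and "z \<noteq> 0"
    and "admissible_lower q (q / (A * z))"
    and "admissible_lower q (1 / (A * z))"
    and "z * (1 - 1 / (A * z)) * phi11 q (B / q) (1 / (A * z)) (1 / (B * z)) \<noteq> 0"
  shows "jfrac_has_value (wall_a q A B) (wall_b2 q A B) z
           (phi11 q B (q / (A * z)) (q / (B * z))
             / (z * (1 - 1 / (A * z)) * phi11 q (B / q) (1 / (A * z)) (1 / (B * z))))"
proof -
  define a c w where "a = B / q" and "c = 1 / (A * z)" and "w = 1 / (B * z)"
  have q: "q \<noteq> 0" "norm q < 1"
    using assms by auto
  \<comment> \<open>These relations eliminate \<open>A\<close> and \<open>B\<close> from the Wall
    coefficients. The last one absorbs the stray \<open>1 / q\<close> in
    \<open>q powi (2 * int n - 1)\<close>.\<close>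
  have AB: "1 / A = z * c" "1 / B = z * w" "A * c = a * q * w" "B = a * q" "1 / q = z * a * w"
    using assms q by (auto simp: a_def c_def w_def)
  \<comment> \<open>Admissibility in product form, which also covers every shifted lower parameter
    \<open>c * q ^ n\<close>.\<close>
  have cq: "c * q ^ j \<noteq> 1" for j
  proof
    assume "c * q ^ j = 1"
    then have "c = q powi (- int j)"
      using q by (simp add: power_int_minus field_simps)
    then show False
      using assms(8) by (auto simp: admissible_lower_def c_def)
  qed
  define X where "X n = phi11 q (a * q ^ n) (c * q ^ n) (w * q ^ n)" for n
  \<comment> \<open>The factors \<open>1 - c * q ^ j\<close> make the coefficient of
    \<open>X n\<close> in the contiguous relation 1; the factors \<open>z\<close> turn
    \<open>\<beta> n / z\<close> into \<open>\<beta> n\<close>.\<close>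
  define \<pi> where "\<pi> n = (\<Prod>j<n. z * (1 - c * q ^ j))" for n
  define k where "k n = X n / \<pi> n" for n
  define \<alpha> where "\<alpha> n = (if n = 0 then 1 else - wall_b2 q A B n)" for n
  define \<beta> where "\<beta> n = z - wall_a q A B n" for n
  have \<pi>: "\<pi> n \<noteq> 0" for n
    using cq assms by (auto simp: \<pi>_def)
  have \<pi>_Suc: "\<pi> (Suc n) = \<pi> n * (z * (1 - c * q ^ n))" for n
    by (simp add: \<pi>_def)
  have qn: "(\<lambda>n. q ^ n) \<longlonglongrightarrow> 0"
    using q by (intro LIMSEQ_power_zero)
  have X1: "X \<longlonglongrightarrow> 1"
    unfolding X_def by (intro phi11_tendsto_one q tendsto_mult_right_zero qn)
  have \<beta>: "\<beta> n = z * (1 - c * q ^ n - w * q ^ n + (1 + q) * (a * q ^ n) * (w * q ^ n))" for n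
  proof -
    have "q powi (2 * int n - 1) = q powi (int n + int n) / q powi 1"
      using q power_int_diff[of q "int n + int n" 1] by simp
    also have "\<dots> = q ^ n * q ^ n / q"
      using q power_int_add[of q "int n" "int n"] by simp
    also have "\<dots> = q ^ n * q ^ n * (z * a * w)"
      unfolding AB(5)[symmetric] by simp
    finally show ?thesis
      unfolding \<beta>_def wall_a_def AB(1,2) by (simp add: algebra_simps)
  qed
  have \<alpha>: "\<alpha> (Suc n) = - (z\<^sup>2 * (q * (c * q ^ n - a * q ^ n * q * (w * q ^ n)) * (w * q ^ n)
      * (1 - a * q ^ n * q)))" for n
  proof -
    have "q powi (2 * int (Suc n) - 1) = q powi int (n + n + 1)"
      by (rule arg_cong[of _ _ "(powi) q"]) simp
    then have "q powi (2 * int (Suc n) - 1) = q ^ n * q ^ n * q"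
      by (simp only: power_int_of_nat power_add power_one_right)
    moreover have "q powi (int (Suc n) - 1) = q ^ n"
      by simp
    ultimately have "wall_b2 q A B (Suc n) =
        q ^ n * q ^ n * q * ((1 / A) * (1 / B)) * (1 - A * q ^ n) * (1 - B * q ^ n)"
      unfolding wall_b2_def by simp
    \<comment> \<open>The factor \<open>c * q ^ n\<close> coming from \<open>1 / A\<close> is
      multiplied into \<open>1 - A * q ^ n\<close>, so that \<open>A\<close> occurs only as
      \<open>A * c\<close>, which equals \<open>a * q * w\<close>.\<close>
    also have "\<dots> = z\<^sup>2 * (q * (c * q ^ n - A * c * q ^ n * q ^ n) * (w * q ^ n) * (1 - B * q ^ n))"
      unfolding AB(1,2) by (simp add: algebra_simps power2_eq_square)
    also have "\<dots> = z\<^sup>2 * (q * (c * q ^ n - a * q ^ n * q * (w * q ^ n)) * (w * q ^ n)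
        * (1 - a * q ^ n * q))"
      unfolding AB(3,4) by (simp add: mult_ac)
    finally show ?thesis
      by (simp add: \<alpha>_def)
  qed
  have rec: "k n = \<beta> n * k (Suc n) + \<alpha> (Suc n) * k (Suc (Suc n))" for n
  proof -
    define Y where "Y = q * (c * q ^ n - a * q ^ n * q * (w * q ^ n)) * (w * q ^ n) * (1 - a * q ^ n * q)"
    define d e where "d = 1 - c * q ^ n" and "e = 1 - c * q ^ n * q"
    have de: "d \<noteq> 0" "e \<noteq> 0"
      using cq[of n] cq[of "Suc n"] by (auto simp: d_def e_def mult_ac)
    have "c * q ^ n * q ^ j \<noteq> 1" for j
      using cq[of "n + j"] by (simp add: power_add mult.assoc)
    from phi11_contiguous[OF q(2) this, of "a * q ^ n" "w * q ^ n"]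
    have "d * X n = (1 - c * q ^ n - w * q ^ n + (1 + q) * (a * q ^ n) * (w * q ^ n)) * X (Suc n)
        - Y / e * X (Suc (Suc n))"
      unfolding X_def Y_def d_def e_def power_Suc2 mult.assoc[symmetric] .
    then have "X n = (\<beta> n / z * X (Suc n) - Y / e * X (Suc (Suc n))) / d"
      using assms(6) de by (simp add: \<beta> nonzero_eq_divide_eq mult.commute)
    moreover have "\<alpha> (Suc n) = - (z\<^sup>2 * Y)"
      by (simp add: \<alpha> Y_def)
    moreover have "\<pi> (Suc n) = \<pi> n * (z * d)" "\<pi> (Suc (Suc n)) = \<pi> n * (z * d) * (z * e)"
      by (simp_all add: \<pi>_Suc d_def e_def mult_ac)
    ultimately show ?thesis
      using assms(6) \<pi>[of n] de by (simp add: k_def diff_divide_distrib power2_eq_square ac_simps)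
  qed
  have "cfrac_has_value \<alpha> \<beta> (\<alpha> 0 * k 1 / k 0)"
  proof (rule cfrac_has_value_of_recurrence[of k \<beta> \<alpha>, OF rec])
    show "\<alpha> n \<noteq> 0" for n
      using assms(5) by (simp add: \<alpha>_def)
    show "k 0 \<noteq> 0"
      using assms(9) by (simp add: k_def X_def \<pi>_def a_def c_def w_def)
    have nz: "\<forall>\<^sub>F n in sequentially. X n \<noteq> 0"
      by (rule tendsto_imp_eventually_ne[OF X1]) simp
    then show "\<forall>\<^sub>F n in sequentially. k n \<noteq> 0"
      by eventually_elim (simp add: k_def \<pi>)
    have X2: "(\<lambda>n. X (Suc (Suc n))) \<longlonglongrightarrow> 1"
      by (intro LIMSEQ_Suc X1)
    \<comment> \<open>The ratio of \<open>k (Suc (Suc n))\<close> to \<open>k n\<close> leaves just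
      two factors of \<open>\<pi>\<close>. The limit results from putting 0 for \<open>q ^ n\<close>
      and 1 for \<open>X\<close>; it is 0 because \<open>\<alpha> (Suc n)\<close> carries powers of
      \<open>q ^ n\<close>.\<close>
    have "(\<lambda>n. - (z\<^sup>2 * (q * (c * q ^ n - a * q ^ n * q * (w * q ^ n)) * (w * q ^ n) * (1 - a * q ^ n * q)))
        * X (Suc (Suc n)) / (z * (1 - c * q ^ n) * (z * (1 - c * (q * q ^ n))) * X n)) \<longlonglongrightarrow>
        - (z\<^sup>2 * (q * (c * 0 - a * 0 * q * (w * 0)) * (w * 0) * (1 - a * 0 * q)))
        * 1 / (z * (1 - c * 0) * (z * (1 - c * (q * 0))) * 1)"
      using assms(6) by (intro tendsto_intros qn X1 X2) auto
    then have "(\<lambda>n. \<alpha> (Suc n) * X (Suc (Suc n)) / (z * (1 - c * q ^ n) * (z * (1 - c * (q * q ^ n))) * X n))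
        \<longlonglongrightarrow> 0"
      by (simp add: \<alpha>)
    then show "(\<lambda>n. \<alpha> (Suc n) * k (Suc (Suc n)) / k n) \<longlonglongrightarrow> 0"
    proof (rule Lim_transform_eventually)
      show "\<forall>\<^sub>F n in sequentially. \<alpha> (Suc n) * X (Suc (Suc n)) /
          (z * (1 - c * q ^ n) * (z * (1 - c * (q * q ^ n))) * X n) = \<alpha> (Suc n) * k (Suc (Suc n)) / k n"
        by (intro always_eventually allI) (simp add: k_def \<pi>_Suc \<pi>)
    qed
  qed
  \<comment> \<open>Here \<open>\<pi> 0 = 1\<close>, and \<open>\<pi> 1\<close> is the prefactor
    \<open>z * (1 - 1 / (A * z))\<close>.\<close>
  moreover have "\<alpha> 0 * k 1 / k 0 = phi11 q B (q / (A * z)) (q / (B * z))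
             / (z * (1 - 1 / (A * z)) * phi11 q (B / q) (1 / (A * z)) (1 / (B * z)))"
    using q by (simp add: \<alpha>_def k_def X_def \<pi>_def a_def c_def w_def)
  ultimately show ?thesis
    by (simp add: jfrac_has_value_def \<alpha>_def[abs_def] \<beta>_def[abs_def])
qed

end
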